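(* Suppose that the metric space $(\mathscr P_p(\mathcal Y),W_p)$ is geodesic and that $\phi(x)=x^p$, $x\in\mathbb R_+$. Then, for every $\rho\in\mathscr P(\Theta)$ with $\rho\ll\pi$, $$\mathcal R^\star_{\phi,p}(\rho)=\int_{\mathscr P_p(\mathcal Y)}d^{\,p}_{\bar B_{\epsilon^\star}(\mu^\star)}(\nu)\,\Lambda_\rho(d\nu),$$ where $$\bar B_{\epsilon^\star}(\mu^\star):=\{\eta\in\mathscr P_p(\mathcal Y):W_p(\mu^\star,\eta)\le\epsilon^\star\},\qquad d_{\bar B_{\epsilon^\star}(\mu^\star)}(\nu):=\inf_{\eta\in\bar B_{\epsilon^\star}(\mu^\star)}W_p(\nu,\eta).$$
   Context: $\mathcal Y\subseteq\mathbb R^{m_{\mathcal Y}}$ with a metric $d_{\mathcal Y}$ such that $(\mathcal Y,d_{\mathcal Y})$ is Polish; $\Theta\subseteq\mathbb R^{m_\Theta}$ has the topology induced by a metric $d_\Theta$. $\mathcal B(X)$ is the Borel $\sigma$-algebra of a topological space $X$ and $\mathscr P(X)$ the set of probability measures on it; $\mathbb R_+=[0,\infty)$. Fix $p\in[1,\infty)$. $\mathscr P_p(\mathcal Y)$ is the set of $\eta\in\mathscr P(\mathcal Y)$ with $\int d_{\mathcal Y}^p(y,y_0)\,\eta(dy)<\infty$ for some (equivalently every) $y_0\in\mathcal Y$, equipped with the $p$-Wasserstein distance $W_p(\mu,\nu):=\big[\inf_{\gamma\in\Pi(\mu,\nu)}\int d_{\mathcal Y}^p(y,z)\,\gamma(dy,dz)\big]^{1/p}$,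 where $\Pi(\mu,\nu)$ is the set of couplings of $\mu$ and $\nu$. The space is geodesic if any two of its points are joined by a constant-speed geodesic $(\eta_s)_{s\in[0,1]}$, i.e. $W_p(\eta_s,\eta_t)=|s-t|\,W_p(\eta_0,\eta_1)$. $\pi\in\mathscr P(\Theta)$ is the prior, $\mu^\star\in\mathscr P_p(\mathcal Y)$ is fixed, and for $\pi$-a.e. $\theta\in\Theta$ a measure $\nu_\theta\in\mathscr P_p(\mathcal Y)$ is given such that $\theta\mapsto W_p(\mu^\star,\nu_\theta)$ is a Borel function $\Theta\to\mathbb R_+$ whose $\pi$-essential infimum equals its minimum, which is attained: $\epsilon^\star:=\operatorname{ess\,inf}_{\theta}W_p(\mu^\star,\nu_\theta)=\min_\theta W_p(\mu^\star,\nu_\theta)$. There is a Borel map $\Phi:\Theta\to\mathscr P_p(\mathcal Y)$ with $\Phi(\theta)=\nu_\theta$ for $\pi$-a.e. $\theta$. For $\rho\in\mathscr P(\Theta)$, $\rho\ll\pi$, put $\Lambda_\rho:=\Phi_\#\rho\in\mathscr P(\mathscr P_p(\mathcal Y))$ (push-forward). For $\phi:\mathbb R_+\to\mathbb R_+$ strictly increasing, continuous at zero, with $\phi(0)=0$, $$\mathcal R^\star_{\phi,p}(\rho):=\int_\Theta\phi\big(W_p(\mu^\star,\nu_\theta)-\epsilon^\star\big)\,\rho(d\theta)\in[0,\infty],\qquad\rho\in\mathscr P(\Theta),\ \rho\ll\pi.$$ *)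

theory Defs
  imports "HOL-Probability.Probability"
begin

definition borel_of :: "'a topology \<Rightarrow> 'a measure" where
  "borel_of X = sigma (topspace X) {U. openin X U}"

abbreviation metric_borel :: "'a set \<Rightarrow> ('a \<Rightarrow> 'a \<Rightarrow> real) \<Rightarrow> 'a measure" where
  "metric_borel M d \<equiv> borel_of (Metric_space.mtopology M d)"

definition prob_measures :: "'a measure \<Rightarrow> 'a measure set" where
  "prob_measures B = {\<eta>. sets \<eta> = sets B \<and> prob_space \<eta>}"

definition polish_topology :: "'a topology \<Rightarrow> bool" where
  "polish_topology X \<longleftrightarrow> separable_space X \<and> completely_metrizable_space X"

definition wasserstein_space ::
  "real \<Rightarrow> 'a set \<Rightarrow> ('a \<Rightarrow> 'a \<Rightarrow> real) \<Rightarrow> 'a measure set" where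
  "wasserstein_space p Y d =
     {\<eta> \<in> prob_measures (metric_borel Y d).
        \<exists>y0\<in>Y. (\<integral>\<^sup>+ y. ennreal (d y y0 powr p) \<partial>\<eta>) < \<infinity>}"

text \<open>On a separable metric space the product of the Borel sigma-algebras is the Borel
  sigma-algebra of the product.\<close>

definition couplings :: "'a measure \<Rightarrow> 'a measure \<Rightarrow> ('a \<times> 'a) measure set" where
  "couplings \<mu> \<nu> =
     {\<gamma> \<in> prob_measures (\<mu> \<Otimes>\<^sub>M \<nu>). distr \<gamma> \<mu> fst = \<mu> \<and> distr \<gamma> \<nu> snd = \<nu>}"

text \<open>The infimum is finite for members of \<^term>\<open>wasserstein_space p Y d\<close>, the only
  arguments for which the value is meaningful.\<close>

definition wasserstein_dist ::
  "real \<Rightarrow> ('a \<Rightarrow> 'a \<Rightarrow> real) \<Rightarrow> 'a measure \<Rightarrow> 'a measure \<Rightarrow> real" where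
  "wasserstein_dist p d \<mu> \<nu> =
     enn2real (INF \<gamma>\<in>couplings \<mu> \<nu>. \<integral>\<^sup>+ (y, z). ennreal (d y z powr p) \<partial>\<gamma>) powr (1 / p)"

definition geodesic_space :: "'a set \<Rightarrow> ('a \<Rightarrow> 'a \<Rightarrow> real) \<Rightarrow> bool" where
  "geodesic_space M d \<longleftrightarrow>
     (\<forall>x\<in>M. \<forall>y\<in>M. \<exists>g. g \<in> {0..1::real} \<rightarrow> M \<and> g 0 = x \<and> g 1 = y \<and>
        (\<forall>s\<in>{0..1}. \<forall>t\<in>{0..1}. d (g s) (g t) = \<bar>s - t\<bar> * d (g 0) (g 1)))"

definition set_dist :: "('a \<Rightarrow> 'a \<Rightarrow> real) \<Rightarrow> 'a set \<Rightarrow> 'a \<Rightarrow> real" where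
  "set_dist d B x = (INF b\<in>B. d x b)"

text \<open>Meaningful when \<^term>\<open>f\<close> is almost everywhere bounded below and
  \<^term>\<open>\<pi>\<close> is a probability measure; \<^term>\<open>f\<close> need only be
  determined almost everywhere.\<close>

definition ess_inf :: "'a measure \<Rightarrow> ('a \<Rightarrow> real) \<Rightarrow> real" where
  "ess_inf \<pi> f = Sup {c. AE x in \<pi>. c \<le> f x}"

definition excess_risk ::
  "(real \<Rightarrow> real) \<Rightarrow> real \<Rightarrow> ('a \<Rightarrow> 'a \<Rightarrow> real) \<Rightarrow> 'a measure \<Rightarrow> ('t \<Rightarrow> 'a measure) \<Rightarrow>
     't measure \<Rightarrow> 't measure \<Rightarrow> ennreal" where
  "excess_risk \<phi> p d \<mu> \<nu> \<pi> \<rho> =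
     (\<integral>\<^sup>+ \<theta>. ennreal (\<phi> (wasserstein_dist p d \<mu> (\<nu> \<theta>)
        - ess_inf \<pi> (\<lambda>\<theta>. wasserstein_dist p d \<mu> (\<nu> \<theta>)))) \<partial>\<rho>)"

end

(*  The closed ball of radius \<epsilon> around \<mu> in a geodesic metric space has distance
    max 0 (W \<mu> \<nu> - \<epsilon>) to a point \<nu>: the triangle inequality gives one bound, and the point at
    distance \<epsilon> from \<mu> on a geodesic to \<nu> attains it.  Since \<epsilon> \<le> W \<mu> (\<nu> \<theta>) almost surely, the two
    integrands agree almost everywhere.  What needs work is that W_p is a metric at all.  Its triangle
    inequality is obtained without disintegration: two couplings are glued by a density that is
    constant on the blocks of a countable partition of Y into small cells. *)

theory Submission
  imports Defs
begin

text \<open>The metric axioms matter because the right-hand side is built on them: the Borel sets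
  and the closed ball of the Wasserstein space come from its \<open>Metric_space\<close> structure,
  and measurability of the integrand rests on continuity of the distance to \<open>\<mu>\<close>.

  The obstacle is that an infimum over couplings yields only nearly optimal ones, so a slack is
  carried through each argument and removed at the end. For separation of points, distance zero
  gives couplings of arbitrarily small cost rather than one living on the diagonal; Markov's
  inequality turns small cost into little mass moved far, which compares closed sets with their
  thickenings.

  The triangle inequality also calls for a bound of Minkowski type. It comes from Jensen's
  inequality with the target bounds themselves as weights: once each distance is divided by its
  bound, the p-th powers recombine to exactly the p-th power of the sum of the bounds.\<close>

section \<open>Convexity of powers and integrals of push-forwards\<close>

lemma convex_on_powr_nonneg:
  fixes p :: real
  assumes "1 \<le> p"
  shows "convex_on {0..} (\<lambda>x. x powr p)"
proof (rule convex_onI)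
  fix t x y :: real
  assume t: "0 < t" "t < 1" and xy: "x \<in> {0..}" "y \<in> {0..}"
  \<comment> \<open>Away from zero \<open>powr_convex\<close> applies. If an endpoint is zero, its
    summand drops out and the claim becomes this bound.\<close>
  have shrink: "(c * z) powr p \<le> c * z powr p" if "0 < c" "c < 1" "0 \<le> z" for c z :: real
  proof -
    have "c powr p \<le> c powr 1"
      using that assms by (intro powr_mono') auto
    then show ?thesis
      using that by (simp add: powr_mult mult_right_mono)
  qed
  show "((1 - t) *\<^sub>R x + t *\<^sub>R y) powr p \<le> (1 - t) * x powr p + t * y powr p"
  proof (cases "x = 0 \<or> y = 0")
    case True
    then show ?thesis
      using shrink[of t y] shrink[of "1 - t" x] t xy assms by auto
  next
    case False
    then show ?thesis
      using convex_onD[OF powr_convex[OF assms], of t x y] t xy by auto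
  qed
qed simp

text \<open>Jensen's inequality with weights \<open>a / s\<close>, \<open>b / s\<close>,
  \<open>c / s\<close>, multiplied by \<open>s powr p\<close>. Three summands are what a path
  through two intermediate points produces. Unit weights give a crude bound for finiteness; adapted
  weights give the sharp one for the triangle inequality.\<close>

lemma powr_sum3_le:
  fixes a b c u v w p :: real
  assumes p: "1 \<le> p" and abc: "0 < a" "0 < b" "0 < c" and uvw: "0 \<le> u" "0 \<le> v" "0 \<le> w"
  shows "(a * u + b * v + c * w) powr p
      \<le> (a + b + c) powr (p - 1) * (a * u powr p + b * v powr p + c * w powr p)"
proof -
  define s where "s = a + b + c"
  have s: "s > 0" using abc by (simp add: s_def)
  have sums: "(\<Sum>i<3::nat. [a / s, b / s, c / s] ! i) = 1"
    using s by (simp add: numeral_3_eq_3 s_def flip: add_divide_distrib)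
  have "(\<Sum>i<3::nat. ([a / s, b / s, c / s] ! i) *\<^sub>R ([u, v, w] ! i)) powr p
      \<le> (\<Sum>i<3::nat. ([a / s, b / s, c / s] ! i) * ([u, v, w] ! i) powr p)"
  proof (rule convex_on_sum[OF _ _ convex_on_powr_nonneg[OF p] sums])
    show "\<And>i. i \<in> {..<3} \<Longrightarrow> 0 \<le> [a / s, b / s, c / s] ! i"
      using abc s by (auto simp: less_Suc_eq numeral_3_eq_3)
    show "\<And>i. i \<in> {..<3} \<Longrightarrow> [u, v, w] ! i \<in> {0..}"
      using uvw by (auto simp: less_Suc_eq numeral_3_eq_3)
  qed (auto simp: lessThan_empty_iff)
  then have *: "(a / s * u + b / s * v + c / s * w) powr p
      \<le> a / s * u powr p + b / s * v powr p + c / s * w powr p"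
    by (simp add: numeral_3_eq_3)
  have "(a * u + b * v + c * w) powr p = (s * (a / s * u + b / s * v + c / s * w)) powr p"
    using s by (simp add: distrib_left)
  also have "\<dots> = s powr p * (a / s * u + b / s * v + c / s * w) powr p"
    by (rule powr_mult)
  also have "\<dots> \<le> s powr p * (a / s * u powr p + b / s * v powr p + c / s * w powr p)"
    using * by (intro mult_left_mono) auto
  also have "\<dots> = s powr (p - 1) * (a * u powr p + b * v powr p + c * w powr p)"
    using s by (simp add: powr_diff field_simps)
  finally show ?thesis by (simp add: s_def)
qed

text \<open>A simple function below \<open>f\<close> pulls back along \<open>T\<close> to a
  measurable function below \<open>f \<circ> T\<close>, whether or not \<open>f\<close> itself is
  measurable. This serves the symmetry of the Wasserstein distance between arbitrary measures, for
  which the cost function need not be measurable.\<close>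

lemma nn_integral_distr_le:
  assumes T: "T \<in> measurable M N"
  shows "(\<integral>\<^sup>+ x. f x \<partial>distr M N T) \<le> (\<integral>\<^sup>+ x. f (T x) \<partial>M)"
proof -
  have "integral\<^sup>S (distr M N T) g \<le> (\<integral>\<^sup>+ x. f (T x) \<partial>M)"
    if g: "simple_function (distr M N T) g" "g \<le> f" for g
  proof -
    have [measurable]: "g \<in> borel_measurable N"
      using borel_measurable_simple_function[OF g(1)] by simp
    have "integral\<^sup>S (distr M N T) g = (\<integral>\<^sup>+ x. g x \<partial>distr M N T)"
      using g by (simp add: nn_integral_eq_simple_integral)
    also have "\<dots> = (\<integral>\<^sup>+ x. g (T x) \<partial>M)"
      by (rule nn_integral_distr) (use T in simp_all)
    also have "\<dots> \<le> (\<integral>\<^sup>+ x. f (T x) \<partial>M)"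
      using g(2) by (intro nn_integral_mono) (auto simp: le_fun_def)
    finally show ?thesis .
  qed
  then show ?thesis
    unfolding nn_integral_def[of "distr M N T"] by (auto intro: SUP_least)
qed

section \<open>Borel sigma-algebras of metric spaces\<close>

lemma space_borel_of [simp]: "space (borel_of X) = topspace X"
  and sets_borel_of: "sets (borel_of X) = sigma_sets (topspace X) {U. openin X U}"
proof -
  have *: "{U. openin X U} \<subseteq> Pow (topspace X)"
    by (auto dest: openin_subset)
  show "space (borel_of X) = topspace X"
    by (simp add: borel_of_def * space_measure_of)
  show "sets (borel_of X) = sigma_sets (topspace X) {U. openin X U}"
    by (simp add: borel_of_def * sets_measure_of)
qed

lemma borel_of_openin: "openin X U \<Longrightarrow> U \<in> sets (borel_of X)"
  by (auto simp: sets_borel_of)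

lemma borel_of_closedin: "closedin X C \<Longrightarrow> C \<in> sets (borel_of X)"
  by (metis borel_of_openin closedin_def double_diff order_refl sets.compl_sets space_borel_of)

lemma borel_measurable_continuous_map:
  fixes f :: "'a \<Rightarrow> real"
  assumes "continuous_map X euclidean f"
  shows "f \<in> borel_measurable (borel_of X)"
proof (rule borel_measurableI)
  fix S :: "real set" assume "open S"
  then have "openin X {x \<in> topspace X. f x \<in> S}"
    using assms by (simp add: continuous_map_def)
  moreover have "f -` S \<inter> space (borel_of X) = {x \<in> topspace X. f x \<in> S}"
    by auto
  ultimately show "f -` S \<inter> space (borel_of X) \<in> sets (borel_of X)"
    by (simp add: borel_of_openin)
qed

lemma (in Metric_space) borel_measurable_dist:
  assumes "x \<in> M"
  shows "d x \<in> borel_measurable (borel_of mtopology)"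
proof (rule borel_measurable_continuous_map)
  have "openin mtopology {y \<in> M. d x y \<in> S}" if "open S" for S
    unfolding openin_mtopology
  proof (intro conjI allI impI)
    fix y assume y: "y \<in> {y \<in> M. d x y \<in> S}"
    then obtain e where e: "0 < e" "\<And>t. dist t (d x y) < e \<Longrightarrow> t \<in> S"
      using \<open>open S\<close> by (auto simp: open_dist)
    have "\<bar>d x z - d x y\<bar> \<le> d y z" if "z \<in> M" for z
      using triangle[of x y z] triangle[of x z y] assms y that by (simp add: commute abs_le_iff)
    then have "mball y e \<subseteq> {y \<in> M. d x y \<in> S}"
      using e(2) by (auto simp: dist_real_def) (meson le_less_trans)
    then show "\<exists>r>0. mball y r \<subseteq> {y \<in> M. d x y \<in> S}"
      using e(1) by blast
  qed auto
  then show "continuous_map mtopology euclidean (d x)"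
    by (simp add: continuous_map_def)
qed

lemma (in Metric_space) separable_dense_sequence:
  assumes "separable_space mtopology" "M \<noteq> {}"
  obtains q :: "nat \<Rightarrow> 'a" where "range q \<subseteq> M" "\<And>x r. x \<in> M \<Longrightarrow> 0 < r \<Longrightarrow> \<exists>n. d x (q n) < r"
proof -
  obtain C where C: "countable C" "C \<subseteq> M" "mtopology closure_of C = M"
    using assms(1) by (auto simp: separable_space_def)
  have ne: "C \<noteq> {}" using C assms(2) by auto
  show thesis
  proof
    show "range (from_nat_into C) \<subseteq> M"
      using from_nat_into[OF ne] C by auto
    fix x r assume "x \<in> M" "(0::real) < r"
    then have "x \<in> mtopology closure_of C" using C(3) by simp
    then obtain y where "y \<in> C" "d x y < r"
      using \<open>0 < r\<close> by (auto simp: metric_closure_of)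
    then show "\<exists>n. d x (from_nat_into C n) < r"
      using from_nat_into_surj[OF C(1)] by metis
  qed
qed

text \<open>Along a dense sequence \<open>q\<close>, the distance of \<open>x\<close> and
  \<open>y\<close> is the infimum of \<open>d (q n) x + d (q n) y\<close>. This is a countable
  infimum of sums of functions of one coordinate each, hence measurable for the product
  sigma-algebra.\<close>

lemma (in Metric_space) borel_measurable_dist_pair:
  assumes "separable_space mtopology"
  shows "(\<lambda>(x, y). d x y) \<in> borel_measurable (borel_of mtopology \<Otimes>\<^sub>M borel_of mtopology)"
proof (cases "M = {}")
  case True
  have "space (borel_of mtopology \<Otimes>\<^sub>M borel_of mtopology) = M \<times> M"
    by (simp add: space_pair_measure)
  with True have "space (borel_of mtopology \<Otimes>\<^sub>M borel_of mtopology) = {}"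
    by (metis Sigma_empty1)
  then show ?thesis
    by (intro measurableI) auto
next
  case False
  then obtain q :: "nat \<Rightarrow> 'a" where q: "range q \<subseteq> M" "\<And>x r. x \<in> M \<Longrightarrow> 0 < r \<Longrightarrow> \<exists>n. d x (q n) < r"
    using separable_dense_sequence[OF assms] by blast
  have [measurable]: "d (q n) \<in> borel_measurable (borel_of mtopology)" for n
    using q(1) by (intro borel_measurable_dist) auto
  have inf: "(INF n. d (q n) x + d (q n) y) = d x y" if xy: "x \<in> M" "y \<in> M" for x y
  proof (rule cInf_eq_non_empty)
    fix v assume "v \<in> range (\<lambda>n. d (q n) x + d (q n) y)"
    then show "d x y \<le> v"
      using that q(1) triangle[of x "q _" y] by (auto simp: commute)
  next
    fix v assume v: "\<And>z. z \<in> range (\<lambda>n. d (q n) x + d (q n) y) \<Longrightarrow> v \<le> z"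
    show "v \<le> d x y"
    proof (rule field_le_epsilon)
      fix e :: real assume "0 < e"
      then obtain n where n: "d x (q n) < e / 2" using q(2)[OF xy(1), of "e / 2"] by auto
      have qn: "q n \<in> M" using q(1) by auto
      have "v \<le> d (q n) x + d (q n) y" using v by auto
      also have "\<dots> \<le> d x (q n) + (d x (q n) + d x y)"
        using triangle[of "q n" x y] qn xy by (simp add: commute)
      finally show "v \<le> d x y + e" using n by linarith
    qed
  qed simp
  have "(\<lambda>w. INF n. d (q n) (fst w) + d (q n) (snd w))
      \<in> borel_measurable (borel_of mtopology \<Otimes>\<^sub>M borel_of mtopology)"
    by (rule borel_measurable_cINF) (auto intro!: bdd_belowI[of _ 0])
  then show ?thesis
    by (rule measurable_cong[THEN iffD1, rotated]) (auto simp: space_pair_measure inf)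
qed

section \<open>Gluing two couplings along a countable partition\<close>

lemma emeasure_distr_level:
  assumes f: "f \<in> measurable M B" and N[measurable]: "N \<in> measurable B (count_space UNIV)"
  shows "emeasure (distr M B f) {y \<in> space B. N y = i} = emeasure M {w \<in> space M. N (f w) = i}"
proof -
  have "f -` {y \<in> space B. N y = i} \<inter> space M = {w \<in> space M. N (f w) = i}"
    using measurable_space[OF f] by auto
  moreover have "{y \<in> space B. N y = i} \<in> sets B"
    by measurable
  ultimately show ?thesis
    using emeasure_distr[OF f] by metis
qed

text \<open>Draw a cell with its mass under \<open>\<eta>\<close>, then draw from
  \<open>\<gamma>1\<close> and \<open>\<gamma>2\<close> independently, each conditioned on its
  middle coordinate lying in that cell. Relative to the product this law has density
  \<open>1 / m i\<close> where both middle coordinates lie in cell \<open>i\<close>, and 0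
  elsewhere. Both couplings give cell \<open>i\<close> the same mass \<open>m i\<close>, so almost
  every section of the density integrates to 1 and both marginals are exact.\<close>

lemma approximate_gluing:
  fixes N :: "'b \<Rightarrow> nat"
  assumes g1: "prob_space \<gamma>1" "sets \<gamma>1 = sets (A \<Otimes>\<^sub>M B)"
    and g2: "prob_space \<gamma>2" "sets \<gamma>2 = sets (B \<Otimes>\<^sub>M C)"
    and eq: "distr \<gamma>1 B snd = \<eta>" "distr \<gamma>2 B fst = \<eta>"
    and N[measurable]: "N \<in> measurable B (count_space UNIV)"
  obtains \<Gamma> where "sets \<Gamma> = sets (\<gamma>1 \<Otimes>\<^sub>M \<gamma>2)" "prob_space \<Gamma>"
    "distr \<Gamma> \<gamma>1 fst = \<gamma>1" "distr \<Gamma> \<gamma>2 snd = \<gamma>2"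
    "AE w in \<Gamma>. N (snd (fst w)) = N (fst (snd w))"
proof -
  interpret G1: prob_space \<gamma>1 by fact
  interpret G2: prob_space \<gamma>2 by fact
  interpret P: pair_prob_space \<gamma>1 \<gamma>2 ..
  have f12: "snd \<in> measurable \<gamma>1 B" "fst \<in> measurable \<gamma>2 B"
    by (simp_all add: measurable_cong_sets[OF g1(2) refl] measurable_cong_sets[OF g2(2) refl])
  define N1 where "N1 w = N (snd w)" for w :: "'a \<times> 'b"
  define N2 where "N2 w = N (fst w)" for w :: "'b \<times> 'c"
  have [measurable]: "N1 \<in> measurable \<gamma>1 (count_space UNIV)" "N2 \<in> measurable \<gamma>2 (count_space UNIV)"
    unfolding N1_def N2_def by (rule measurable_compose[OF _ N]; rule f12)+
  define m where "m i = emeasure \<eta> {y \<in> space B. N y = i}" for i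
  have m1: "emeasure \<gamma>1 {w \<in> space \<gamma>1. N1 w = i} = m i" for i
    unfolding N1_def m_def eq(1)[symmetric]
    by (rule emeasure_distr_level[symmetric]) (rule f12 N)+
  have m2: "emeasure \<gamma>2 {w \<in> space \<gamma>2. N2 w = i} = m i" for i
    unfolding N2_def m_def eq(2)[symmetric]
    by (rule emeasure_distr_level[symmetric]) (rule f12 N)+
  have fin: "m i \<noteq> \<infinity>" for i
    using m1[of i] G1.emeasure_finite[of "{w \<in> space \<gamma>1. N1 w = i}"] by simp
  \<comment> \<open>In a cell of mass zero the section integral \<open>1 / m i * m i\<close> would
    be 0 instead of 1. There are countably many cells, so those of mass zero form a null set
    together.\<close>
  have ae1: "AE w in \<gamma>1. m (N1 w) \<noteq> 0"
  proof -
    have "AE w in \<gamma>1. \<forall>i. m i = 0 \<longrightarrow> N1 w \<noteq> i"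
      unfolding AE_all_countable
    proof
      fix i
      show "AE w in \<gamma>1. m i = 0 \<longrightarrow> N1 w \<noteq> i"
        using m1[of i] by (cases "m i = 0") (auto intro!: AE_I[of _ _ "{w \<in> space \<gamma>1. N1 w = i}"])
    qed
    then show ?thesis by eventually_elim auto
  qed
  have ae2: "AE w in \<gamma>2. m (N2 w) \<noteq> 0"
  proof -
    have "AE w in \<gamma>2. \<forall>i. m i = 0 \<longrightarrow> N2 w \<noteq> i"
      unfolding AE_all_countable
    proof
      fix i
      show "AE w in \<gamma>2. m i = 0 \<longrightarrow> N2 w \<noteq> i"
        using m2[of i] by (cases "m i = 0") (auto intro!: AE_I[of _ _ "{w \<in> space \<gamma>2. N2 w = i}"])
    qed
    then show ?thesis by eventually_elim auto
  qed
  define h :: "('a \<times> 'b) \<times> ('b \<times> 'c) \<Rightarrow> ennreal"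
    where "h w = (if N1 (fst w) = N2 (snd w) then 1 / m (N1 (fst w)) else 0)" for w
  have [measurable]: "m \<in> measurable (count_space UNIV) borel"
    by simp
  have [measurable]: "(\<lambda>w. m (N1 (fst w))) \<in> borel_measurable (\<gamma>1 \<Otimes>\<^sub>M \<gamma>2)"
    by measurable
  have [measurable]: "Measurable.pred (\<gamma>1 \<Otimes>\<^sub>M \<gamma>2) (\<lambda>w. N1 (fst w) = N2 (snd w))"
  proof -
    have "Measurable.pred (\<gamma>1 \<Otimes>\<^sub>M \<gamma>2) (\<lambda>w. \<exists>i. N1 (fst w) = i \<and> N2 (snd w) = i)"
      by measurable
    also have "(\<lambda>w. \<exists>i. N1 (fst w) = i \<and> N2 (snd w) = i) = (\<lambda>w. N1 (fst w) = N2 (snd w))"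
      by auto
    finally show ?thesis .
  qed
  have [measurable]: "h \<in> borel_measurable (\<gamma>1 \<Otimes>\<^sub>M \<gamma>2)"
    unfolding h_def by measurable
  define \<Gamma> where "\<Gamma> = density (\<gamma>1 \<Otimes>\<^sub>M \<gamma>2) h"
  have sets: "sets \<Gamma> = sets (\<gamma>1 \<Otimes>\<^sub>M \<gamma>2)" by (simp add: \<Gamma>_def)
  have inv: "1 / m i * m i = 1" if "m i \<noteq> 0" for i
    using that fin[of i] by (simp add: ennreal_divide_times less_top)
  have int2: "AE w in \<gamma>1. (\<integral>\<^sup>+ w'. h (w, w') \<partial>\<gamma>2) = 1"
    using ae1
  proof eventually_elim
    case (elim w)
    have "(\<integral>\<^sup>+ w'. h (w, w') \<partial>\<gamma>2)
        = (\<integral>\<^sup>+ w'. 1 / m (N1 w) * indicator {w' \<in> space \<gamma>2. N2 w' = N1 w} w' \<partial>\<gamma>2)"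
      by (rule nn_integral_cong) (auto simp: h_def split: split_indicator)
    also have "\<dots> = 1 / m (N1 w) * m (N1 w)"
      by (subst nn_integral_cmult_indicator) (auto simp: m2)
    finally show ?case using elim inv by simp
  qed
  have int1: "AE w' in \<gamma>2. (\<integral>\<^sup>+ w. h (w, w') \<partial>\<gamma>1) = 1"
    using ae2
  proof eventually_elim
    case (elim w')
    have "(\<integral>\<^sup>+ w. h (w, w') \<partial>\<gamma>1)
        = (\<integral>\<^sup>+ w. 1 / m (N2 w') * indicator {w \<in> space \<gamma>1. N1 w = N2 w'} w \<partial>\<gamma>1)"
      by (rule nn_integral_cong) (auto simp: h_def split: split_indicator)
    also have "\<dots> = 1 / m (N2 w') * m (N2 w')"
      by (subst nn_integral_cmult_indicator) (auto simp: m1)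
    finally show ?case using elim inv by simp
  qed
  have [measurable_cong]: "sets \<Gamma> = sets (\<gamma>1 \<Otimes>\<^sub>M \<gamma>2)" by fact
  have fst_eq: "distr \<Gamma> \<gamma>1 fst = \<gamma>1"
  proof (rule measure_eqI)
    fix X assume "X \<in> sets (distr \<Gamma> \<gamma>1 fst)"
    then have [measurable]: "X \<in> sets \<gamma>1" by simp
    have "emeasure (distr \<Gamma> \<gamma>1 fst) X = (\<integral>\<^sup>+ w. indicator X w \<partial>distr \<Gamma> \<gamma>1 fst)"
      by simp
    also have "\<dots> = (\<integral>\<^sup>+ w. indicator X (fst w) \<partial>\<Gamma>)"
      by (rule nn_integral_distr) auto
    also have "\<dots> = (\<integral>\<^sup>+ w. h w * indicator X (fst w) \<partial>(\<gamma>1 \<Otimes>\<^sub>M \<gamma>2))"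
      unfolding \<Gamma>_def by (rule nn_integral_density) auto
    also have "\<dots> = (\<integral>\<^sup>+ w. \<integral>\<^sup>+ w'. h (w, w') * indicator X w \<partial>\<gamma>2 \<partial>\<gamma>1)"
      by (subst G2.nn_integral_fst[symmetric]) auto
    also have "\<dots> = (\<integral>\<^sup>+ w. (\<integral>\<^sup>+ w'. h (w, w') \<partial>\<gamma>2) * indicator X w \<partial>\<gamma>1)"
      by (intro nn_integral_cong nn_integral_multc) auto
    also have "\<dots> = (\<integral>\<^sup>+ w. indicator X w \<partial>\<gamma>1)"
      using int2 by (intro nn_integral_cong_AE) auto
    finally show "emeasure (distr \<Gamma> \<gamma>1 fst) X = emeasure \<gamma>1 X" by simp
  qed simp
  have snd_eq: "distr \<Gamma> \<gamma>2 snd = \<gamma>2"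
  proof (rule measure_eqI)
    fix X assume "X \<in> sets (distr \<Gamma> \<gamma>2 snd)"
    then have [measurable]: "X \<in> sets \<gamma>2" by simp
    have "emeasure (distr \<Gamma> \<gamma>2 snd) X = (\<integral>\<^sup>+ w. indicator X w \<partial>distr \<Gamma> \<gamma>2 snd)"
      by simp
    also have "\<dots> = (\<integral>\<^sup>+ w. indicator X (snd w) \<partial>\<Gamma>)"
      by (rule nn_integral_distr) auto
    also have "\<dots> = (\<integral>\<^sup>+ w. h w * indicator X (snd w) \<partial>(\<gamma>1 \<Otimes>\<^sub>M \<gamma>2))"
      unfolding \<Gamma>_def by (rule nn_integral_density) auto
    also have "\<dots> = (\<integral>\<^sup>+ w'. \<integral>\<^sup>+ w. h (w, w') * indicator X w' \<partial>\<gamma>1 \<partial>\<gamma>2)"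
      by (subst P.nn_integral_snd[symmetric]) auto
    also have "\<dots> = (\<integral>\<^sup>+ w'. (\<integral>\<^sup>+ w. h (w, w') \<partial>\<gamma>1) * indicator X w' \<partial>\<gamma>2)"
      by (intro nn_integral_cong nn_integral_multc) auto
    also have "\<dots> = (\<integral>\<^sup>+ w'. indicator X w' \<partial>\<gamma>2)"
      using int1 by (intro nn_integral_cong_AE) auto
    finally show "emeasure (distr \<Gamma> \<gamma>2 snd) X = emeasure \<gamma>2 X" by simp
  qed simp
  have prob: "prob_space \<Gamma>"
    by (rule prob_space_distrD[of fst _ \<gamma>1]) (use g1 in \<open>simp_all add: fst_eq\<close>)
  have "AE w in \<Gamma>. N1 (fst w) = N2 (snd w)"
    unfolding \<Gamma>_def by (subst AE_density) (auto simp: h_def)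
  then have "AE w in \<Gamma>. N (snd (fst w)) = N (fst (snd w))"
    by (simp add: N1_def N2_def)
  then show thesis
    using that sets prob fst_eq snd_eq by blast
qed

section \<open>Transport cost and symmetry of the Wasserstein distance\<close>

definition transport_cost :: "real \<Rightarrow> ('a \<Rightarrow> 'a \<Rightarrow> real) \<Rightarrow> ('a \<times> 'a) measure \<Rightarrow> ennreal" where
  "transport_cost p d \<gamma> = (\<integral>\<^sup>+ (y, z). ennreal (d y z powr p) \<partial>\<gamma>)"

lemma wasserstein_dist_transport_cost:
  "wasserstein_dist p d \<mu> \<nu> = enn2real (INF \<gamma>\<in>couplings \<mu> \<nu>. transport_cost p d \<gamma>) powr (1 / p)"
  by (simp add: wasserstein_dist_def transport_cost_def)

text \<open>Stated for arbitrary measures because \<^const>\<open>Metric_space\<close> asks for symmetry on the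
  whole type.\<close>

lemma wasserstein_dist_commute:
  assumes d: "\<And>x y. d x y = d y x"
  shows "wasserstein_dist p d \<mu> \<nu> = wasserstein_dist p d \<nu> \<mu>"
proof -
  have le: "(INF \<gamma>\<in>couplings \<mu> \<nu>. transport_cost p d \<gamma>) \<le> (INF \<gamma>\<in>couplings \<nu> \<mu>. transport_cost p d \<gamma>)"
    for \<mu> \<nu> :: "'a measure"
  proof (rule INF_greatest)
    fix \<gamma> assume \<gamma>: "\<gamma> \<in> couplings \<nu> \<mu>"
    then have sets[measurable_cong]: "sets \<gamma> = sets (\<nu> \<Otimes>\<^sub>M \<mu>)" and "prob_space \<gamma>"
      and marg: "distr \<gamma> \<nu> fst = \<nu>" "distr \<gamma> \<mu> snd = \<mu>"
      by (auto simp: couplings_def prob_measures_def)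
    interpret prob_space \<gamma> by fact
    have sw[measurable]: "(\<lambda>(x, y). (y, x)) \<in> measurable \<gamma> (\<mu> \<Otimes>\<^sub>M \<nu>)"
      by measurable
    define \<gamma>' where "\<gamma>' = distr \<gamma> (\<mu> \<Otimes>\<^sub>M \<nu>) (\<lambda>(x, y). (y, x))"
    have "distr \<gamma>' \<mu> fst = distr \<gamma> \<mu> snd" "distr \<gamma>' \<nu> snd = distr \<gamma> \<nu> fst"
      unfolding \<gamma>'_def by (subst distr_distr[OF _ sw]; simp add: comp_def case_prod_beta)+
    moreover have "prob_space \<gamma>'"
      unfolding \<gamma>'_def by (rule prob_space_distr) fact
    ultimately have "\<gamma>' \<in> couplings \<mu> \<nu>"
      using marg by (simp add: couplings_def prob_measures_def) (simp add: \<gamma>'_def)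
    \<comment> \<open>One inequality suffices: \<open>le\<close> is quantified over both measures
      and is used in both directions.\<close>
    moreover have "transport_cost p d \<gamma>' \<le> transport_cost p d \<gamma>"
      using nn_integral_distr_le[OF sw, of "\<lambda>(x, y). ennreal (d x y powr p)"]
      by (simp add: transport_cost_def \<gamma>'_def case_prod_beta' d[of "snd _" "fst _"])
    ultimately show "(INF \<gamma>\<in>couplings \<mu> \<nu>. transport_cost p d \<gamma>) \<le> transport_cost p d \<gamma>"
      by (rule INF_lower2)
  qed
  show ?thesis
    unfolding wasserstein_dist_transport_cost by (simp only: antisym[OF le[of \<mu> \<nu>] le[of \<nu> \<mu>]])
qed

section \<open>Couplings and their costs over a separable metric space\<close>

locale separable_wasserstein = Metric_space Y d for Y :: "'a set" and d :: "'a \<Rightarrow> 'a \<Rightarrow> real" +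
  fixes p :: real
  assumes separable: "separable_space mtopology" and p_ge_1: "1 \<le> p"
begin

abbreviation "B \<equiv> borel_of mtopology"
abbreviation "P \<equiv> wasserstein_space p Y d"
abbreviation "W \<equiv> wasserstein_dist p d"
abbreviation "cost \<equiv> transport_cost p d"

lemma wasserstein_spaceD:
  assumes "\<mu> \<in> P"
  shows "prob_space \<mu>" "sets \<mu> = sets B" "space \<mu> = Y"
proof -
  show "prob_space \<mu>" and s: "sets \<mu> = sets B"
    using assms by (auto simp: wasserstein_space_def prob_measures_def)
  show "space \<mu> = Y"
    using sets_eq_imp_space_eq[OF s] by simp
qed

lemma dist_pair_measurable [measurable]: "(\<lambda>w. d (fst w) (snd w)) \<in> borel_measurable (B \<Otimes>\<^sub>M B)"
  using borel_measurable_dist_pair[OF separable] by (simp add: case_prod_beta')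

lemma couplings_iff:
  assumes "\<mu> \<in> P" "\<nu> \<in> P"
  shows "\<gamma> \<in> couplings \<mu> \<nu> \<longleftrightarrow>
    prob_space \<gamma> \<and> sets \<gamma> = sets (B \<Otimes>\<^sub>M B) \<and> distr \<gamma> B fst = \<mu> \<and> distr \<gamma> B snd = \<nu>"
proof -
  note s = wasserstein_spaceD(2)[OF assms(1)] wasserstein_spaceD(2)[OF assms(2)]
  have "distr \<gamma> \<mu> fst = distr \<gamma> B fst" "distr \<gamma> \<nu> snd = distr \<gamma> B snd"
    using s by (auto intro!: distr_cong)
  moreover have "sets (\<mu> \<Otimes>\<^sub>M \<nu>) = sets (B \<Otimes>\<^sub>M B)"
    using s by (rule sets_pair_measure_cong)
  ultimately show ?thesis
    by (auto simp: couplings_def prob_measures_def)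
qed

lemma nn_integral_marginals:
  assumes "sets \<gamma> = sets (B \<Otimes>\<^sub>M B)" "f \<in> borel_measurable B"
  shows "(\<integral>\<^sup>+ w. f (fst w) \<partial>\<gamma>) = (\<integral>\<^sup>+ x. f x \<partial>distr \<gamma> B fst)"
    and "(\<integral>\<^sup>+ w. f (snd w) \<partial>\<gamma>) = (\<integral>\<^sup>+ x. f x \<partial>distr \<gamma> B snd)"
proof -
  have [measurable]: "fst \<in> measurable \<gamma> B" "snd \<in> measurable \<gamma> B"
    by (simp_all add: measurable_cong_sets[OF assms(1) refl])
  show "(\<integral>\<^sup>+ w. f (fst w) \<partial>\<gamma>) = (\<integral>\<^sup>+ x. f x \<partial>distr \<gamma> B fst)"
    "(\<integral>\<^sup>+ w. f (snd w) \<partial>\<gamma>) = (\<integral>\<^sup>+ x. f x \<partial>distr \<gamma> B snd)"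
    using assms(2) by (simp_all add: nn_integral_distr)
qed

text \<open>The independent coupling has finite cost: route each pair through the base points
  \<open>y\<close> and \<open>z\<close> that witness the finite moments of the two measures.
  Finiteness matters because \<open>enn2real\<close> maps infinity to 0, so only a finite infimum
  can be recovered from \<open>W\<close>.\<close>

lemma INF_cost_finite:
  assumes \<mu>: "\<mu> \<in> P" and \<nu>: "\<nu> \<in> P"
  shows "(INF \<gamma>\<in>couplings \<mu> \<nu>. cost \<gamma>) < \<infinity>"
proof -
  interpret M: prob_space \<mu> using wasserstein_spaceD[OF \<mu>] by simp
  interpret N: prob_space \<nu> using wasserstein_spaceD[OF \<nu>] by simp
  interpret pair_prob_space \<mu> \<nu> ..
  note s = wasserstein_spaceD(2)[OF \<mu>] wasserstein_spaceD(2)[OF \<nu>]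
  let ?\<gamma> = "\<mu> \<Otimes>\<^sub>M \<nu>"
  have sets: "sets ?\<gamma> = sets (B \<Otimes>\<^sub>M B)"
    using s by (rule sets_pair_measure_cong)
  have marg: "distr ?\<gamma> B fst = \<mu>" "distr ?\<gamma> B snd = \<nu>"
  proof -
    have "distr ?\<gamma> B fst = distr ?\<gamma> \<mu> fst" "distr ?\<gamma> B snd = distr ?\<gamma> \<nu> snd"
      using s by (auto intro!: distr_cong)
    moreover have "distr ?\<gamma> \<nu> snd = \<nu>"
    proof (rule measure_eqI)
      fix X assume X: "X \<in> sets (distr ?\<gamma> \<nu> snd)"
      have "snd -` X \<inter> space ?\<gamma> = space \<mu> \<times> X"
        using X sets.sets_into_space by (auto simp: space_pair_measure)
      then show "emeasure (distr ?\<gamma> \<nu> snd) X = emeasure \<nu> X"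
        using X by (simp add: emeasure_distr N.emeasure_pair_measure_Times M.emeasure_space_1)
    qed simp
    ultimately show "distr ?\<gamma> B fst = \<mu>" "distr ?\<gamma> B snd = \<nu>"
      by (simp_all add: N.distr_pair_fst)
  qed
  have \<gamma>: "?\<gamma> \<in> couplings \<mu> \<nu>"
    unfolding couplings_iff[OF assms] using sets marg prob_space_axioms by simp
  obtain y z where y: "y \<in> Y" "(\<integral>\<^sup>+ x. ennreal (d x y powr p) \<partial>\<mu>) < \<infinity>"
    and z: "z \<in> Y" "(\<integral>\<^sup>+ x. ennreal (d x z powr p) \<partial>\<nu>) < \<infinity>"
    using \<mu> \<nu> by (auto simp: wasserstein_space_def)
  have "(\<lambda>x. d x u) \<in> borel_measurable B" if "u \<in> Y" for u
    using borel_measurable_dist[OF that] by (subst commute)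
  with y z have [measurable]: "(\<lambda>x. d x y) \<in> borel_measurable B" "(\<lambda>x. d x z) \<in> borel_measurable B"
    by simp_all
  \<comment> \<open>The factor of \<open>powr_sum3_le\<close> for unit weights.\<close>
  let ?K = "3 powr (p - 1)"
  note [measurable_cong] = sets
  have "cost ?\<gamma> \<le> (\<integral>\<^sup>+ w. ennreal ?K * (ennreal (d (fst w) y powr p) + ennreal (d y z powr p)
      + ennreal (d (snd w) z powr p)) \<partial>?\<gamma>)"
    unfolding transport_cost_def case_prod_beta
  proof (rule nn_integral_mono)
    fix w assume "w \<in> space ?\<gamma>"
    then have w: "fst w \<in> Y" "snd w \<in> Y"
      by (auto simp: space_pair_measure wasserstein_spaceD(3)[OF \<mu>] wasserstein_spaceD(3)[OF \<nu>])
    have "d (fst w) (snd w) \<le> d (fst w) y + d y z + d (snd w) z"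
      using triangle[of "fst w" y "snd w"] triangle[of y z "snd w"] w y z by (simp add: commute)
    then have "d (fst w) (snd w) powr p \<le> (1 * d (fst w) y + 1 * d y z + 1 * d (snd w) z) powr p"
      using p_ge_1 by (intro powr_mono2) auto
    also have "\<dots> \<le> ?K * (d (fst w) y powr p + d y z powr p + d (snd w) z powr p)"
      using powr_sum3_le[OF p_ge_1, of 1 1 1 "d (fst w) y" "d y z" "d (snd w) z"] by simp
    finally have "ennreal (d (fst w) (snd w) powr p)
      \<le> ennreal (?K * (d (fst w) y powr p + d y z powr p + d (snd w) z powr p))"
      by (rule ennreal_leI)
    then show "ennreal (d (fst w) (snd w) powr p) \<le> ennreal ?K * (ennreal (d (fst w) y powr p)
      + ennreal (d y z powr p) + ennreal (d (snd w) z powr p))"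
      by (simp add: ennreal_mult flip: ennreal_plus)
  qed
  also have "\<dots> = ennreal ?K * ((\<integral>\<^sup>+ w. ennreal (d (fst w) y powr p) \<partial>?\<gamma>) + ennreal (d y z powr p)
      + (\<integral>\<^sup>+ w. ennreal (d (snd w) z powr p) \<partial>?\<gamma>))"
    by (simp add: nn_integral_cmult nn_integral_add emeasure_space_1)
  also have "\<dots> < \<infinity>"
    using y(2) z(2)
    by (subst nn_integral_marginals[OF sets], simp, subst nn_integral_marginals[OF sets], simp)
      (simp add: marg ennreal_mult_less_top)
  finally have "cost ?\<gamma> < \<infinity>" .
  then show ?thesis
    using \<gamma> by (auto simp: INF_less_iff)
qed

text \<open>Nearly optimal couplings stand in for optimal ones: any strict upper bound of
  \<open>W\<close> exceeds the cost of some coupling after taking p-th powers.\<close>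

lemma coupling_of_wasserstein_less:
  assumes "\<mu> \<in> P" "\<nu> \<in> P" "W \<mu> \<nu> < a"
  obtains \<gamma> where "\<gamma> \<in> couplings \<mu> \<nu>" "cost \<gamma> < ennreal (a powr p)"
proof -
  let ?I = "INF \<gamma>\<in>couplings \<mu> \<nu>. cost \<gamma>"
  have "enn2real ?I = W \<mu> \<nu> powr p"
    using p_ge_1 by (simp add: wasserstein_dist_transport_cost powr_powr)
  also have "\<dots> < a powr p"
    using assms(3) p_ge_1 by (intro powr_less_mono2) (auto simp: wasserstein_dist_transport_cost)
  finally have "ennreal (enn2real ?I) < ennreal (a powr p)"
    by (simp only: ennreal_less_iff[OF enn2real_nonneg])
  then have "?I < ennreal (a powr p)"
    using INF_cost_finite[OF assms(1,2)] by simp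
  then show thesis
    using that by (auto simp: INF_less_iff)
qed

lemma wasserstein_le_of_coupling:
  assumes "\<gamma> \<in> couplings \<mu> \<nu>" "cost \<gamma> \<le> ennreal (a powr p)" "0 \<le> a"
  shows "W \<mu> \<nu> \<le> a"
proof -
  let ?I = "INF \<gamma>\<in>couplings \<mu> \<nu>. cost \<gamma>"
  have "?I \<le> ennreal (a powr p)"
    using assms by (auto intro: INF_lower2)
  then have "enn2real ?I \<le> a powr p"
    by (intro enn2real_leI) auto
  then have "W \<mu> \<nu> \<le> (a powr p) powr (1 / p)"
    unfolding wasserstein_dist_transport_cost using p_ge_1 by (intro powr_mono2) auto
  then show ?thesis
    using assms(3) p_ge_1 by (simp add: powr_powr)
qed

lemma wasserstein_self:
  assumes "\<mu> \<in> P"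
  shows "W \<mu> \<mu> = 0"
proof -
  note \<mu> = wasserstein_spaceD[OF assms]
  interpret prob_space \<mu> by (rule \<mu>)
  have D: "(\<lambda>x. (x, x)) \<in> measurable \<mu> (B \<Otimes>\<^sub>M B)"
    by (simp add: measurable_cong_sets[OF \<mu>(2) refl])
  let ?\<gamma> = "distr \<mu> (B \<Otimes>\<^sub>M B) (\<lambda>x. (x, x))"
  have "distr \<mu> B (\<lambda>x. x) = \<mu>"
    using distr_id2[OF \<mu>(2)[symmetric]] by (simp add: id_def)
  then have \<gamma>: "?\<gamma> \<in> couplings \<mu> \<mu>"
    unfolding couplings_iff[OF assms assms]
    using prob_space_distr[OF D] by (simp add: distr_distr[OF _ D] comp_def)
  have "cost ?\<gamma> = (\<integral>\<^sup>+ x. ennreal (d x x powr p) \<partial>\<mu>)"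
    unfolding transport_cost_def case_prod_beta by (subst nn_integral_distr[OF D]) auto
  moreover have "(\<integral>\<^sup>+ x. ennreal (d x x powr p) \<partial>\<mu>) = (\<integral>\<^sup>+ x. 0 \<partial>\<mu>)"
  proof (rule nn_integral_cong)
    fix x assume "x \<in> space \<mu>"
    then have "x \<in> Y"
      using \<mu>(3) by blast
    then show "ennreal (d x x powr p) = 0"
      by simp
  qed
  ultimately have "cost ?\<gamma> \<le> ennreal (0 powr p)"
    by simp
  with \<gamma> have "W \<mu> \<mu> \<le> 0"
    by (rule wasserstein_le_of_coupling) simp
  then show ?thesis
    by (simp add: wasserstein_dist_transport_cost)
qed

section \<open>Triangle inequality\<close>

text \<open>The cells are the balls of radius \<open>e / 2\<close> around a dense sequence, each
  with the earlier balls removed: \<open>LEAST\<close> selects the first centre that is close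
  enough, and two points sharing a centre are within \<open>e\<close> of each other.\<close>

lemma countable_partition_small_cells:
  assumes "Y \<noteq> {}" "0 < e"
  obtains N :: "'a \<Rightarrow> nat" where "N \<in> measurable B (count_space UNIV)"
    "\<And>y z. y \<in> Y \<Longrightarrow> z \<in> Y \<Longrightarrow> N y = N z \<Longrightarrow> d y z \<le> e"
proof -
  obtain q :: "nat \<Rightarrow> 'a" where q: "range q \<subseteq> Y" "\<And>x r. x \<in> Y \<Longrightarrow> 0 < r \<Longrightarrow> \<exists>n. d x (q n) < r"
    using separable_dense_sequence[OF separable assms(1)] by blast
  define N where "N y = (LEAST n. d (q n) y < e / 2)" for y
  have [measurable]: "d (q n) \<in> borel_measurable B" for n
    using q(1) by (intro borel_measurable_dist) auto
  have near: "d (q (N y)) y < e / 2" if "y \<in> Y" for y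
    unfolding N_def using q(2)[OF that, of "e / 2"] assms(2) by (auto intro: LeastI simp: commute)
  show thesis
  proof
    show "N \<in> measurable B (count_space UNIV)"
      unfolding N_def by measurable
    fix y z assume yz: "y \<in> Y" "z \<in> Y" "N y = N z"
    have "d y z \<le> d (q (N y)) y + d (q (N y)) z"
      using triangle[of y "q (N y)" z] yz q(1) by (auto simp: commute)
    then show "d y z \<le> e"
      using near[OF yz(1)] near[OF yz(2)] yz(3) by simp
  qed
qed

text \<open>An exact gluing would need a disintegration of the two couplings over their common marginal.
  Gluing only up to a countable partition into cells of diameter at most \<open>e\<close> costs an
  extra \<open>e\<close> in the inequality, which vanishes in the limit.\<close>

lemma wasserstein_triangle:
  assumes \<mu>: "\<mu> \<in> P" and \<eta>: "\<eta> \<in> P" and \<nu>: "\<nu> \<in> P"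
  shows "W \<mu> \<nu> \<le> W \<mu> \<eta> + W \<eta> \<nu>"
proof (rule field_le_epsilon)
  fix e' :: real assume "0 < e'"
  \<comment> \<open>One third of the slack goes to each of the two nearly optimal couplings and one
    third to the diameter of the cells. It also keeps \<open>a\<close> and \<open>b\<close> positive
    when a Wasserstein distance is zero.\<close>
  define e where "e = e' / 3"
  have e: "0 < e" using \<open>0 < e'\<close> by (simp add: e_def)
  define a where "a = W \<mu> \<eta> + e"
  define b where "b = W \<eta> \<nu> + e"
  define s where "s = a + e + b"
  have "0 \<le> W \<mu> \<eta>" "0 \<le> W \<eta> \<nu>"
    by (simp_all add: wasserstein_dist_transport_cost)
  then have pos: "0 < a" "0 < b" "0 < s"
    using e unfolding a_def b_def s_def by linarith+
  obtain \<gamma>1 where \<gamma>1: "\<gamma>1 \<in> couplings \<mu> \<eta>" "cost \<gamma>1 < ennreal (a powr p)"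
    using coupling_of_wasserstein_less[OF \<mu> \<eta>, of a] e by (auto simp: a_def)
  obtain \<gamma>2 where \<gamma>2: "\<gamma>2 \<in> couplings \<eta> \<nu>" "cost \<gamma>2 < ennreal (b powr p)"
    using coupling_of_wasserstein_less[OF \<eta> \<nu>, of b] e by (auto simp: b_def)
  have c1: "prob_space \<gamma>1" "sets \<gamma>1 = sets (B \<Otimes>\<^sub>M B)" "distr \<gamma>1 B fst = \<mu>" "distr \<gamma>1 B snd = \<eta>"
    using \<gamma>1(1) by (auto simp: couplings_iff[OF \<mu> \<eta>])
  have c2: "prob_space \<gamma>2" "sets \<gamma>2 = sets (B \<Otimes>\<^sub>M B)" "distr \<gamma>2 B fst = \<eta>" "distr \<gamma>2 B snd = \<nu>"
    using \<gamma>2(1) by (auto simp: couplings_iff[OF \<eta> \<nu>])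
  have "Y \<noteq> {}"
    using \<mu> by (auto simp: wasserstein_space_def)
  then obtain N :: "'a \<Rightarrow> nat" where N: "N \<in> measurable B (count_space UNIV)"
    "\<And>y z. y \<in> Y \<Longrightarrow> z \<in> Y \<Longrightarrow> N y = N z \<Longrightarrow> d y z \<le> e"
    using countable_partition_small_cells[OF _ e] by metis
  obtain \<Gamma> where \<Gamma>: "sets \<Gamma> = sets (\<gamma>1 \<Otimes>\<^sub>M \<gamma>2)" "prob_space \<Gamma>"
    "distr \<Gamma> \<gamma>1 fst = \<gamma>1" "distr \<Gamma> \<gamma>2 snd = \<gamma>2" "AE w in \<Gamma>. N (snd (fst w)) = N (fst (snd w))"
    by (rule approximate_gluing[OF c1(1,2) c2(1,2) c1(4) c2(3) N(1)])
  interpret \<Gamma>: prob_space \<Gamma> by fact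
  have sets\<Gamma>: "sets \<Gamma> = sets ((B \<Otimes>\<^sub>M B) \<Otimes>\<^sub>M (B \<Otimes>\<^sub>M B))"
    unfolding \<Gamma>(1) using c1(2) c2(2) by (rule sets_pair_measure_cong)
  note cong = measurable_cong_sets[OF sets\<Gamma> refl]
  have proj: "fst \<in> measurable \<Gamma> \<gamma>1" "snd \<in> measurable \<Gamma> \<gamma>2"
    by (simp_all add: measurable_cong_sets[OF \<Gamma>(1) refl])
  have proj': "fst \<in> measurable \<gamma>1 B" "snd \<in> measurable \<gamma>2 B"
    by (simp_all add: measurable_cong_sets[OF c1(2) refl] measurable_cong_sets[OF c2(2) refl])
  \<comment> \<open>Only the outer coordinates survive; the two middle ones may differ, but almost
    surely share a cell.\<close>
  define T :: "('a \<times> 'a) \<times> ('a \<times> 'a) \<Rightarrow> 'a \<times> 'a" where "T w = (fst (fst w), snd (snd w))" for w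
  have T: "T \<in> measurable \<Gamma> (B \<Otimes>\<^sub>M B)"
    unfolding T_def cong by measurable
  define \<gamma> where "\<gamma> = distr \<Gamma> (B \<Otimes>\<^sub>M B) T"
  have "distr \<gamma> B fst = distr \<Gamma> B (fst \<circ> fst)"
    unfolding \<gamma>_def by (subst distr_distr[OF _ T]) (simp_all add: comp_def T_def)
  also have "\<dots> = distr (distr \<Gamma> \<gamma>1 fst) B fst"
    by (rule distr_distr[symmetric, OF proj'(1) proj(1)])
  finally have fst: "distr \<gamma> B fst = \<mu>"
    by (simp add: \<Gamma>(3) c1)
  have "distr \<gamma> B snd = distr \<Gamma> B (snd \<circ> snd)"
    unfolding \<gamma>_def by (subst distr_distr[OF _ T]) (simp_all add: comp_def T_def)
  also have "\<dots> = distr (distr \<Gamma> \<gamma>2 snd) B snd"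
    by (rule distr_distr[symmetric, OF proj'(2) proj(2)])
  finally have snd: "distr \<gamma> B snd = \<nu>"
    by (simp add: \<Gamma>(4) c2)
  have \<gamma>: "\<gamma> \<in> couplings \<mu> \<nu>"
    unfolding couplings_iff[OF \<mu> \<nu>] using fst snd \<Gamma>.prob_space_distr[OF T] by (simp add: \<gamma>_def)
  \<comment> \<open>The Jensen weights are \<open>a\<close>, \<open>e\<close>, \<open>b\<close>, so
    each distance is first divided by its bound, which puts \<open>a powr p\<close> and
    \<open>b powr p\<close> into the denominators. The bounds on the two costs cancel them, leaving
    \<open>s powr (p - 1) * (a + e + b) = s powr p\<close>.\<close>
  define ka where "ka = s powr (p - 1) * a / a powr p"
  define kb where "kb = s powr (p - 1) * b / b powr p"
  define ke where "ke = s powr (p - 1) * e"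
  have k: "0 \<le> ka" "0 \<le> kb" "0 \<le> ke"
    using pos e by (auto simp: ka_def kb_def ke_def)
  let ?f1 = "\<lambda>w. ennreal (d (fst w) (snd w) powr p)"
  have f: "?f1 \<in> borel_measurable \<gamma>1" "?f1 \<in> borel_measurable \<gamma>2"
    by (simp_all add: measurable_cong_sets[OF c1(2) refl] measurable_cong_sets[OF c2(2) refl])
  have int1: "(\<integral>\<^sup>+ w. ?f1 (fst w) \<partial>\<Gamma>) = cost \<gamma>1"
    using nn_integral_distr[OF proj(1), of ?f1] f by (simp add: \<Gamma>(3) transport_cost_def case_prod_beta')
  have int2: "(\<integral>\<^sup>+ w. ?f1 (snd w) \<partial>\<Gamma>) = cost \<gamma>2"
    using nn_integral_distr[OF proj(2), of ?f1] f by (simp add: \<Gamma>(4) transport_cost_def case_prod_beta')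
  have "cost \<gamma> = (\<integral>\<^sup>+ w. ennreal (d (fst (fst w)) (snd (snd w)) powr p) \<partial>\<Gamma>)"
    unfolding transport_cost_def \<gamma>_def case_prod_beta
    by (subst nn_integral_distr[OF T]) (auto simp: T_def)
  also have "\<dots> \<le> (\<integral>\<^sup>+ w. ennreal ka * ?f1 (fst w) + ennreal ke + ennreal kb * ?f1 (snd w) \<partial>\<Gamma>)"
  proof (rule nn_integral_mono_AE)
    show "AE w in \<Gamma>. ennreal (d (fst (fst w)) (snd (snd w)) powr p)
        \<le> ennreal ka * ?f1 (fst w) + ennreal ke + ennreal kb * ?f1 (snd w)"
      using \<Gamma>(5) AE_space
    proof eventually_elim
      case (elim w)
      obtain x y y' z where w: "w = ((x, y), (y', z))"
        by (metis prod.collapse)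
      have Y: "x \<in> Y" "y \<in> Y" "y' \<in> Y" "z \<in> Y"
        using elim(2) by (auto simp: w sets_eq_imp_space_eq[OF sets\<Gamma>] space_pair_measure)
      have "d y y' \<le> e"
        using elim(1) N(2) Y by (simp add: w)
      then have "d x z \<le> d x y + e + d y' z"
        using triangle[of x y z] triangle[of y y' z] Y by simp
      also have "\<dots> = a * (d x y / a) + e * 1 + b * (d y' z / b)"
        using pos by simp
      finally have "d x z powr p \<le> (a * (d x y / a) + e * 1 + b * (d y' z / b)) powr p"
        using p_ge_1 by (intro powr_mono2) auto
      also have "\<dots> \<le> s powr (p - 1) * (a * (d x y / a) powr p + e * 1 powr p + b * (d y' z / b) powr p)"
        unfolding s_def using pos e by (intro powr_sum3_le p_ge_1) auto
      also have "\<dots> = ka * d x y powr p + ke + kb * d y' z powr p"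
        using pos by (simp add: ka_def kb_def ke_def powr_divide algebra_simps)
      finally have "ennreal (d x z powr p) \<le> ennreal (ka * d x y powr p + ke + kb * d y' z powr p)"
        by (rule ennreal_leI)
      also have "\<dots> = ennreal ka * ennreal (d x y powr p) + ennreal ke + ennreal kb * ennreal (d y' z powr p)"
        using k by (simp add: ennreal_mult ennreal_plus)
      finally show ?case
        by (simp add: w)
    qed
  qed
  also have "\<dots> = ennreal ka * cost \<gamma>1 + ennreal ke + ennreal kb * cost \<gamma>2"
    using measurable_compose[OF proj(1) f(1)] measurable_compose[OF proj(2) f(2)]
    by (simp add: nn_integral_add nn_integral_cmult int1 int2 \<Gamma>.emeasure_space_1)
  also have "\<dots> \<le> ennreal ka * ennreal (a powr p) + ennreal ke + ennreal kb * ennreal (b powr p)"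
    using \<gamma>1(2) \<gamma>2(2) by (intro add_mono mult_left_mono) auto
  also have "\<dots> = ennreal (ka * a powr p + ke + kb * b powr p)"
    using k by (simp add: ennreal_mult ennreal_plus)
  also have "ka * a powr p + ke + kb * b powr p = s powr (p - 1) * (a + e + b)"
    using pos by (simp add: ka_def kb_def ke_def algebra_simps)
  also have "\<dots> = s powr p"
    using pos by (simp add: s_def[symmetric] powr_diff)
  finally have "W \<mu> \<nu> \<le> s"
    using wasserstein_le_of_coupling[OF \<gamma>] pos by simp
  then show "W \<mu> \<nu> \<le> W \<mu> \<eta> + W \<eta> \<nu> + e'"
    by (simp add: s_def a_def b_def e_def)
qed

section \<open>Separation of points\<close>

text \<open>A pair that starts in \<open>C\<close> either ends in the thickening or is at distance
  at least \<open>r\<close>. By Markov's inequality a cheap coupling gives the second event mass at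
  most \<open>t\<close>.\<close>

lemma emeasure_closed_le_thickening:
  assumes \<mu>: "\<mu> \<in> P" and \<nu>: "\<nu> \<in> P" and W: "W \<mu> \<nu> = 0" and C: "closedin mtopology C" and r: "0 < r"
  shows "emeasure \<mu> C \<le> emeasure \<nu> (\<Union>c\<in>C. mball c r)"
proof (rule ennreal_le_epsilon)
  fix t :: real assume t: "0 < t"
  define U where "U = (\<Union>c\<in>C. mball c r)"
  have [measurable]: "C \<in> sets B" "U \<in> sets B"
    using C by (auto simp: U_def intro: borel_of_closedin borel_of_openin)
  \<comment> \<open>The p-th power of this bound is \<open>r powr p * t\<close>, from which the
    Markov factor \<open>1 / r powr p\<close> leaves exactly \<open>t\<close>.\<close>
  obtain \<gamma> where \<gamma>: "\<gamma> \<in> couplings \<mu> \<nu>" "cost \<gamma> < ennreal ((r * t powr (1 / p)) powr p)"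
    using coupling_of_wasserstein_less[OF \<mu> \<nu>, of "r * t powr (1 / p)"] W r t by auto
  have c: "prob_space \<gamma>" "sets \<gamma> = sets (B \<Otimes>\<^sub>M B)" "distr \<gamma> B fst = \<mu>" "distr \<gamma> B snd = \<nu>"
    using \<gamma>(1) by (auto simp: couplings_iff[OF \<mu> \<nu>])
  note [measurable_cong] = c(2)
  have sp: "space \<gamma> = Y \<times> Y"
    using sets_eq_imp_space_eq[OF c(2)] by (simp add: space_pair_measure)
  let ?f = "\<lambda>w. ennreal (d (fst w) (snd w) powr p)"
  let ?k = "ennreal (1 / r powr p)"
  let ?far = "{w \<in> space \<gamma>. 1 \<le> ?k * ?f w}"
  have "emeasure \<mu> C = emeasure \<gamma> (fst -` C \<inter> space \<gamma>)"
    unfolding c(3)[symmetric] by (rule emeasure_distr) measurable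
  also have "\<dots> \<le> emeasure \<gamma> ((snd -` U \<inter> space \<gamma>) \<union> ?far)"
  proof (rule emeasure_mono)
    show "fst -` C \<inter> space \<gamma> \<subseteq> (snd -` U \<inter> space \<gamma>) \<union> ?far"
    proof
      fix w assume w: "w \<in> fst -` C \<inter> space \<gamma>"
      show "w \<in> (snd -` U \<inter> space \<gamma>) \<union> ?far"
      proof (cases "d (fst w) (snd w) < r")
        case True
        then show ?thesis
          using w by (auto simp: U_def sp in_mball)
      next
        case False
        then have "r powr p \<le> d (fst w) (snd w) powr p"
          using r p_ge_1 by (intro powr_mono2) auto
        then have "1 \<le> 1 / r powr p * d (fst w) (snd w) powr p"
          using r by simp
        then have "ennreal 1 \<le> ennreal (1 / r powr p * d (fst w) (snd w) powr p)"
          by (rule ennreal_leI)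
        also have "\<dots> = ?k * ?f w"
          by (rule ennreal_mult) auto
        finally show ?thesis
          using w by simp
      qed
    qed
  qed measurable
  also have "\<dots> \<le> emeasure \<gamma> (snd -` U \<inter> space \<gamma>) + emeasure \<gamma> ?far"
    by (rule emeasure_subadditive) measurable
  also have "emeasure \<gamma> (snd -` U \<inter> space \<gamma>) = emeasure \<nu> U"
    unfolding c(4)[symmetric] by (rule emeasure_distr[symmetric]) measurable
  also have "emeasure \<gamma> ?far \<le> ?k * (\<integral>\<^sup>+ w. ?f w * indicator (space \<gamma>) w \<partial>\<gamma>)"
    by (rule nn_integral_Markov_inequality) measurable
  also have "(\<integral>\<^sup>+ w. ?f w * indicator (space \<gamma>) w \<partial>\<gamma>) = cost \<gamma>"
    unfolding transport_cost_def case_prod_beta by (rule nn_integral_cong) simp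
  also have "?k * cost \<gamma> \<le> ?k * ennreal ((r * t powr (1 / p)) powr p)"
    using \<gamma>(2) by (intro mult_left_mono) auto
  also have "\<dots> = ennreal t"
    using r t p_ge_1 by (simp add: powr_mult powr_powr flip: ennreal_mult)
  finally show "emeasure \<mu> C \<le> emeasure \<nu> (\<Union>c\<in>C. mball c r) + ennreal t"
    by (simp add: U_def add_left_mono)
qed

text \<open>The thickenings of radius \<open>1 / Suc n\<close> decrease to the closure of
  \<open>C\<close>, which is \<open>C\<close> itself, and the finite measure \<open>\<nu>\<close> is
  continuous from above.\<close>

lemma emeasure_closed_le:
  assumes \<mu>: "\<mu> \<in> P" and \<nu>: "\<nu> \<in> P" and W: "W \<mu> \<nu> = 0" and C: "closedin mtopology C"
  shows "emeasure \<mu> C \<le> emeasure \<nu> C"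
proof -
  interpret prob_space \<nu> using wasserstein_spaceD[OF \<nu>] by simp
  define U where "U n = (\<Union>c\<in>C. mball c (1 / real (Suc n)))" for n
  have "(\<Inter>n. U n) \<subseteq> mtopology closure_of C"
  proof
    fix x assume x: "x \<in> (\<Inter>n. U n)"
    then have "x \<in> Y" by (auto simp: U_def)
    moreover have "\<exists>y\<in>C. y \<in> mball x r" if r: "0 < r" for r
    proof -
      obtain n where n: "1 / real (Suc n) < r"
        using nat_approx_posE[OF r] by (auto simp: inverse_eq_divide)
      from x have "x \<in> U n" by simp
      then show ?thesis
        using n by (force simp: U_def commute)
    qed
    ultimately show "x \<in> mtopology closure_of C"
      by (simp add: metric_closure_of)
  qed
  then have "(\<Inter>n. U n) \<subseteq> C"
    using C closure_of_eq by metis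
  moreover have "C \<subseteq> (\<Inter>n. U n)"
    using closedin_subset[OF C] by (force simp: U_def)
  ultimately have Int: "(\<Inter>n. U n) = C" by blast
  have "decseq U"
  proof (rule decseq_SucI)
    fix n
    have "1 / real (Suc (Suc n)) \<le> 1 / real (Suc n)"
      by (simp add: field_simps)
    then have "mball c (1 / real (Suc (Suc n))) \<subseteq> mball c (1 / real (Suc n))" for c
      by (rule mball_subset_concentric)
    then show "U (Suc n) \<subseteq> U n"
      unfolding U_def by blast
  qed
  moreover have "range U \<subseteq> sets \<nu>"
    using wasserstein_spaceD(2)[OF \<nu>] by (auto simp: U_def intro!: borel_of_openin)
  ultimately have "(\<lambda>n. emeasure \<nu> (U n)) \<longlonglongrightarrow> emeasure \<nu> (\<Inter>n. U n)"
    by (intro Lim_emeasure_decseq) auto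
  then have "(\<lambda>n. emeasure \<nu> (U n)) \<longlonglongrightarrow> emeasure \<nu> C"
    by (simp only: Int)
  moreover have "emeasure \<mu> C \<le> emeasure \<nu> (U n)" for n
    unfolding U_def by (rule emeasure_closed_le_thickening[OF \<mu> \<nu> W C]) simp
  ultimately show ?thesis
    by (intro LIMSEQ_le_const) auto
qed

text \<open>By symmetry of \<open>W\<close> the comparison on closed sets holds both ways.
  Complements give agreement on open sets, an intersection-stable generator of the Borel
  sets.\<close>

lemma wasserstein_zero_imp_eq:
  assumes \<mu>: "\<mu> \<in> P" and \<nu>: "\<nu> \<in> P" and W: "W \<mu> \<nu> = 0"
  shows "\<mu> = \<nu>"
proof (rule measure_eqI_generator_eq[where E = "{U. openin mtopology U}" and \<Omega> = Y and A = "\<lambda>_. Y"])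
  interpret M: prob_space \<mu> using wasserstein_spaceD[OF \<mu>] by simp
  interpret N: prob_space \<nu> using wasserstein_spaceD[OF \<nu>] by simp
  note s = wasserstein_spaceD(2,3)[OF \<mu>] wasserstein_spaceD(2,3)[OF \<nu>]
  have W': "W \<nu> \<mu> = 0"
    using W wasserstein_dist_commute[of d p \<nu> \<mu>] commute by simp
  show "Int_stable {U. openin mtopology U}"
    by (auto simp: Int_stable_def)
  show "{U. openin mtopology U} \<subseteq> Pow Y"
    by (auto simp: openin_mtopology)
  show "sets \<mu> = sigma_sets Y {U. openin mtopology U}" "sets \<nu> = sigma_sets Y {U. openin mtopology U}"
    using s by (simp_all add: sets_borel_of)
  show "range (\<lambda>_. Y) \<subseteq> {U. openin mtopology U}"
    using openin_topspace[of mtopology] by auto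
  show "emeasure \<mu> Y \<noteq> \<infinity>" for i :: nat
    by simp
  fix U assume "U \<in> {U. openin mtopology U}"
  then have U: "openin mtopology U" and "U \<subseteq> Y"
    by (auto simp: openin_mtopology)
  have C: "closedin mtopology (Y - U)"
    using closedin_diff[OF closedin_topspace U] by simp
  have "emeasure \<mu> (Y - U) = emeasure \<nu> (Y - U)"
    using emeasure_closed_le[OF \<mu> \<nu> W C] emeasure_closed_le[OF \<nu> \<mu> W' C] by (rule antisym)
  moreover have "U \<in> sets \<mu>" "U \<in> sets \<nu>" "Y - U \<in> sets \<mu>" "Y - U \<in> sets \<nu>"
    using U C s by (simp_all add: borel_of_openin borel_of_closedin)
  ultimately show "emeasure \<mu> U = emeasure \<nu> U"
    using M.prob_compl[of U] N.prob_compl[of U] s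
    by (simp add: M.emeasure_eq_measure N.emeasure_eq_measure)
qed auto

theorem Metric_space_wasserstein: "Metric_space P W"
proof
  show "0 \<le> W \<mu> \<nu>" for \<mu> \<nu>
    by (simp add: wasserstein_dist_transport_cost)
  show "W \<mu> \<nu> = W \<nu> \<mu>" for \<mu> \<nu>
    using commute by (rule wasserstein_dist_commute)
  show "W \<mu> \<nu> = 0 \<longleftrightarrow> \<mu> = \<nu>" if "\<mu> \<in> P" "\<nu> \<in> P" for \<mu> \<nu>
    using that wasserstein_self wasserstein_zero_imp_eq by auto
  show "W \<mu> \<nu> \<le> W \<mu> \<eta> + W \<eta> \<nu>" if "\<mu> \<in> P" "\<eta> \<in> P" "\<nu> \<in> P" for \<mu> \<eta> \<nu>
    using that by (rule wasserstein_triangle)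
qed

end

section \<open>Distance to a ball in a geodesic space, and the risk identity\<close>

lemma (in Metric_space) set_dist_mcball_geodesic:
  assumes geo: "geodesic_space M d" and x: "x \<in> M" and y: "y \<in> M" and r: "0 \<le> r"
  shows "set_dist d (mcball x r) y = max 0 (d x y - r)"
  unfolding set_dist_def
proof (rule cInf_eq_minimum)
  show "max 0 (d x y - r) \<in> d y ` mcball x r"
  proof (cases "d x y \<le> r")
    case True
    then have "y \<in> mcball x r" "max 0 (d x y - r) = d y y"
      using x y by auto
    then show ?thesis by blast
  next
    case False
    obtain g where g: "g \<in> {0..1::real} \<rightarrow> M" "g 0 = x" "g 1 = y"
      and gd: "\<forall>s\<in>{0..1}. \<forall>t\<in>{0..1}. d (g s) (g t) = \<bar>s - t\<bar> * d (g 0) (g 1)"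
      using geo x y unfolding geodesic_space_def by metis
    \<comment> \<open>The time at which the constant-speed geodesic from \<open>x\<close> to
      \<open>y\<close> has covered the distance \<open>r\<close>; it is at most 1 because
      \<open>y\<close> lies outside the ball.\<close>
    define t where "t = r / d x y"
    have D: "0 < d x y"
      using False r by linarith
    have t: "t \<in> {0..1}"
      using False r D by (auto simp: t_def)
    have "g t \<in> M" using g(1) t by auto
    moreover have "d x (g t) = r"
      using gd[rule_format, of 0 t] t g(2,3) D r by (simp add: t_def)
    moreover have "d y (g t) = d x y - r"
      using gd[rule_format, of 1 t] t g(2,3) D r by (simp add: t_def left_diff_distrib)
    ultimately have "g t \<in> mcball x r" "max 0 (d x y - r) = d y (g t)"
      using x False by auto
    then show ?thesis by blast
  qed
next
  fix v assume "v \<in> d y ` mcball x r"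
  then obtain b where "b \<in> M" "d x b \<le> r" "v = d y b" by auto
  then show "max 0 (d x y - r) \<le> v"
    using triangle[of x b y] x y by (simp add: commute)
qed

theorem theorem4p2:
  fixes Y :: "(real ^ 'm) set" and dY :: "real ^ 'm \<Rightarrow> real ^ 'm \<Rightarrow> real"
    and \<Theta> :: "(real ^ 'n) set" and d\<Theta> :: "real ^ 'n \<Rightarrow> real ^ 'n \<Rightarrow> real"
    and p \<epsilon> :: real
    and \<pi> \<rho> :: "(real ^ 'n) measure"
    and \<mu> :: "(real ^ 'm) measure"
    and D :: "(real ^ 'n) set"
    and \<nu> \<Phi> :: "real ^ 'n \<Rightarrow> (real ^ 'm) measure"
    and \<phi> :: "real \<Rightarrow> real"
  defines "\<epsilon> \<equiv> ess_inf \<pi> (\<lambda>\<theta>. wasserstein_dist p dY \<mu> (\<nu> \<theta>))"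
  assumes "Metric_space Y dY" and "polish_topology (Metric_space.mtopology Y dY)"
    and "Metric_space \<Theta> d\<Theta>"
    and "1 \<le> p"
    and "\<pi> \<in> prob_measures (metric_borel \<Theta> d\<Theta>)"
    and "\<mu> \<in> wasserstein_space p Y dY"
    and "D \<subseteq> \<Theta>" and "AE \<theta> in \<pi>. \<theta> \<in> D"
    and "\<And>\<theta>. \<theta> \<in> D \<Longrightarrow> \<nu> \<theta> \<in> wasserstein_space p Y dY"
    and "(\<lambda>\<theta>. wasserstein_dist p dY \<mu> (\<nu> \<theta>))
           \<in> borel_measurable (restrict_space (metric_borel \<Theta> d\<Theta>) D)"
    and "\<exists>\<theta>\<^sub>0\<in>D. wasserstein_dist p dY \<mu> (\<nu> \<theta>\<^sub>0) = \<epsilon> \<and>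
           (\<forall>\<theta>\<in>D. \<epsilon> \<le> wasserstein_dist p dY \<mu> (\<nu> \<theta>))"
    and "\<Phi> \<in> metric_borel \<Theta> d\<Theta> \<rightarrow>\<^sub>M
               metric_borel (wasserstein_space p Y dY) (wasserstein_dist p dY)"
    and "AE \<theta> in \<pi>. \<Phi> \<theta> = \<nu> \<theta>"
    and "geodesic_space (wasserstein_space p Y dY) (wasserstein_dist p dY)"
    and "\<And>x. 0 \<le> x \<Longrightarrow> \<phi> x = x powr p"
    and "\<rho> \<in> prob_measures (metric_borel \<Theta> d\<Theta>)" and "absolutely_continuous \<pi> \<rho>"
  shows "excess_risk \<phi> p dY \<mu> \<nu> \<pi> \<rho> =
     (\<integral>\<^sup>+ \<eta>. ennreal (set_dist (wasserstein_dist p dY)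
          (Metric_space.mcball (wasserstein_space p Y dY) (wasserstein_dist p dY) \<mu> \<epsilon>) \<eta> powr p)
        \<partial>(distr \<rho> (metric_borel (wasserstein_space p Y dY) (wasserstein_dist p dY)) \<Phi>))"
proof -
  let ?P = "wasserstein_space p Y dY"
  let ?W = "wasserstein_dist p dY"
  let ?B = "metric_borel \<Theta> d\<Theta>"
  interpret Y: separable_wasserstein Y dY p
    using assms(2,3,5) by (simp add: separable_wasserstein_def separable_wasserstein_axioms_def polish_topology_def)
  interpret P: Metric_space ?P ?W
    by (rule Y.Metric_space_wasserstein)
  obtain \<theta>\<^sub>0 where "?W \<mu> (\<nu> \<theta>\<^sub>0) = \<epsilon>" and min: "\<And>\<theta>. \<theta> \<in> D \<Longrightarrow> \<epsilon> \<le> ?W \<mu> (\<nu> \<theta>)"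
    using assms(12) by auto
  \<comment> \<open>The essential infimum is a supremum of reals with no sign built in; its sign
    comes from being attained as a value of the distance.\<close>
  then have \<epsilon>: "0 \<le> \<epsilon>"
    by (metis P.nonneg)
  let ?dist = "set_dist ?W (P.mcball \<mu> \<epsilon>)"
  have dist: "?dist \<eta> = max 0 (?W \<mu> \<eta> - \<epsilon>)" if "\<eta> \<in> ?P" for \<eta>
    using P.set_dist_mcball_geodesic[OF assms(15) assms(7) that \<epsilon>] .
  have sets: "sets \<pi> = sets ?B" "sets \<rho> = sets ?B"
    using assms(6,17) by (auto simp: prob_measures_def)
  have \<Phi>: "\<Phi> \<in> measurable \<rho> (borel_of P.mtopology)"
    using assms(13) by (simp add: measurable_cong_sets[OF sets(2) refl])
  \<comment> \<open>The change of variables below needs a measurable integrand. The closed formula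
    provides it, since the distance to \<open>\<mu>\<close> is continuous.\<close>
  have "(\<lambda>\<eta>. ennreal (max 0 (?W \<mu> \<eta> - \<epsilon>) powr p)) \<in> borel_measurable (borel_of P.mtopology)"
    using P.borel_measurable_dist[OF assms(7)] by measurable
  then have meas: "(\<lambda>\<eta>. ennreal (?dist \<eta> powr p)) \<in> borel_measurable (borel_of P.mtopology)"
    by (rule measurable_cong[THEN iffD1, rotated]) (simp add: dist)
  have "AE \<theta> in \<pi>. \<theta> \<in> D \<and> \<Phi> \<theta> = \<nu> \<theta>"
    using assms(9,14) by eventually_elim simp
  then have ae: "AE \<theta> in \<rho>. \<theta> \<in> D \<and> \<Phi> \<theta> = \<nu> \<theta>"
    using absolutely_continuous_AE[OF _ assms(18)] sets by simp
  have "excess_risk \<phi> p dY \<mu> \<nu> \<pi> \<rho> = (\<integral>\<^sup>+ \<theta>. ennreal (\<phi> (?W \<mu> (\<nu> \<theta>) - \<epsilon>)) \<partial>\<rho>)"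
    by (simp add: excess_risk_def \<epsilon>_def)
  also have "\<dots> = (\<integral>\<^sup>+ \<theta>. ennreal (?dist (\<Phi> \<theta>) powr p) \<partial>\<rho>)"
  proof (rule nn_integral_cong_AE, use ae in eventually_elim)
    fix \<theta> assume \<theta>: "\<theta> \<in> D \<and> \<Phi> \<theta> = \<nu> \<theta>"
    \<comment> \<open>Nonnegativity is used twice: it removes the \<open>max\<close> from the
      distance formula, and it puts the argument of \<open>\<phi>\<close> where
      \<open>\<phi>\<close> is known to be the p-th power.\<close>
    then have "0 \<le> ?W \<mu> (\<nu> \<theta>) - \<epsilon>"
      using min by simp
    moreover from this have "?dist (\<Phi> \<theta>) = ?W \<mu> (\<nu> \<theta>) - \<epsilon>"
      using dist assms(10) \<theta> by simp
    ultimately show "ennreal (\<phi> (?W \<mu> (\<nu> \<theta>) - \<epsilon>)) = ennreal (?dist (\<Phi> \<theta>) powr p)"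
      using assms(16) by simp
  qed
  also have "\<dots> = (\<integral>\<^sup>+ \<eta>. ennreal (?dist \<eta> powr p) \<partial>distr \<rho> (borel_of P.mtopology) \<Phi>)"
    using nn_integral_distr[OF \<Phi>] meas by simp
  finally show ?thesis .
qed

end
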